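(* Let $I$ be an open interval in $\mathbb{R}$. If $f\in S^1(I)$ and $f^{\mathrm{sd}}\in C^0(I)$, then $f \in C^1(I)$ and $f'=f^{\mathrm{sd}}$ on $I$.
   Context: For an open interval $I\subset\mathbb{R}$, a function $f:I\to\mathbb{R}$ and a point $x\in I$, the specular derivative of $f$ at $x$ is $$f^{\mathrm{sd}}(x) := \lim_{h \searrow 0} \mathcal{A}(f(x + h) - f(x), f(x) - f(x - h), h)$$ (with $h>0$ small enough that $x\pm h\in I$), where $\mathcal{A}:\mathbb{R}\times\mathbb{R}\times(0,\infty)\to\mathbb{R}$ is $$\mathcal{A}(a, b, c) := \frac{a \sqrt{b^2 + c^2} + b \sqrt{a^2 + c^2}}{c \sqrt{a^2 + c^2} + c \sqrt{b^2 + c^2}}.$$ $f$ is specularly differentiable at $x$ if this limit exists as a finite real number, and specularly differentiable on $I$ if it is so at every point of $I$. $S^0(I)$ is the set of functions $f:I\to\mathbb{R}$ that are specularly differentiable on $I$, and $S^1(I):=C^0(I)\cap S^0(I)$. $C^0(I)$ and $C^1(I)$ are the spaces of continuous, respectively continuously differentiable (in the classical sense), real-valued functions on $I$; $f'$ is the classical derivative. *)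

theory Defs
  imports "HOL-Analysis.Analysis"
begin

text \<open>Only used for \<open>c > 0\<close>, where the denominator is positive.\<close>
definition specular_A :: "real \<Rightarrow> real \<Rightarrow> real \<Rightarrow> real" where
  "specular_A a b c =
     (a * sqrt (b\<^sup>2 + c\<^sup>2) + b * sqrt (a\<^sup>2 + c\<^sup>2)) /
     (c * sqrt (a\<^sup>2 + c\<^sup>2) + c * sqrt (b\<^sup>2 + c\<^sup>2))"

text \<open>A function on an open interval \<open>I\<close> is represented by a total function. For \<open>x \<in> I\<close> the
  filter \<open>at_right 0\<close> only sees small \<open>h > 0\<close>, for which \<open>x + h\<close> and \<open>x - h\<close> lie in \<open>I\<close>, so
  values outside \<open>I\<close> are irrelevant.\<close>
definition has_specular_derivative :: "(real \<Rightarrow> real) \<Rightarrow> real \<Rightarrow> real \<Rightarrow> bool" where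
  "has_specular_derivative f L x \<longleftrightarrow>
     ((\<lambda>h. specular_A (f (x + h) - f x) (f x - f (x - h)) h) \<longlongrightarrow> L) (at_right 0)"

definition specularly_differentiable :: "(real \<Rightarrow> real) \<Rightarrow> real \<Rightarrow> bool" where
  "specularly_differentiable f x \<longleftrightarrow> (\<exists>L. has_specular_derivative f L x)"

text \<open>Unspecified where the limit does not exist, as for \<open>deriv\<close>.\<close>
definition specular_deriv :: "(real \<Rightarrow> real) \<Rightarrow> real \<Rightarrow> real" where
  "specular_deriv f x = (THE L. has_specular_derivative f L x)"

definition S0 :: "real set \<Rightarrow> (real \<Rightarrow> real) set" where
  "S0 I = {f. \<forall>x\<in>I. specularly_differentiable f x}"

definition C0 :: "real set \<Rightarrow> (real \<Rightarrow> real) set" where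
  "C0 I = {f. continuous_on I f}"

definition S1 :: "real set \<Rightarrow> (real \<Rightarrow> real) set" where
  "S1 I = C0 I \<inter> S0 I"

definition C1 :: "real set \<Rightarrow> (real \<Rightarrow> real) set" where
  "C1 I = {f. (\<forall>x\<in>I. f differentiable (at x)) \<and> continuous_on I (deriv f)}"

end

theory Submission
  imports Defs
begin

text \<open>For \<open>c > 0\<close> the number \<open>specular_A a b c\<close> is a weighted mean of the two slopes \<open>a / c\<close>
  and \<open>b / c\<close>, so it is at least \<open>m\<close> as soon as both slopes are. This is the only property of
  the specular derivative, apart from its oddness in \<open>f\<close>, that the proof uses.

  It yields a one-sided mean value inequality. Suppose that \<open>f\<close> is continuous on \<open>[a, b]\<close> with
  mean slope greater than \<open>m\<close>, and put \<open>g x = f x - m x\<close>, so that \<open>g a < g b\<close>. At an extremum of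
  \<open>g\<close> the left and right slopes of \<open>f\<close> lie on opposite sides of \<open>m\<close> and nothing can be said about
  their mean. One looks instead at the first point \<open>c\<close> after which \<open>g\<close> exceeds some intermediate
  level \<open>k\<close>: to the left of \<open>c\<close> we have \<open>g \<le> k = g c\<close>, and arbitrarily close to the right of \<open>c\<close>
  there are points with \<open>g > k\<close>. For the corresponding steps \<open>h\<close> both one-sided slopes of \<open>f\<close> at
  \<open>c\<close> are at least \<open>m\<close>, so the specular derivative at \<open>c\<close> is at least \<open>m\<close>
  (\<open>specular_mean_value_ge\<close>).

  Consequently bounds on the specular derivative over an interval bound the difference quotients
  (\<open>specular_mean_value_upper\<close>, \<open>specular_mean_value_lower\<close>). If the specular derivative is
  continuous at \<open>x\<close>, it is within \<open>e\<close> of its value at \<open>x\<close> on a small interval around \<open>x\<close>, hence so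
  are all difference quotients based at \<open>x\<close>, and \<open>f\<close> is differentiable at \<open>x\<close> with that
  derivative.\<close>

lemma specular_A_ge:
  assumes "c > 0" and "m * c \<le> a" and "m * c \<le> b"
  shows "m \<le> specular_A a b c"
proof -
  let ?u = "sqrt (a\<^sup>2 + c\<^sup>2)" and ?v = "sqrt (b\<^sup>2 + c\<^sup>2)"
  have pos: "?u > 0" "?v > 0"
    using \<open>c > 0\<close> by (simp_all add: add_nonneg_pos)
  have "(m * c) * ?v \<le> a * ?v" "(m * c) * ?u \<le> b * ?u"
    using assms pos by (auto intro!: mult_right_mono)
  then have "m * (c * ?u + c * ?v) \<le> a * ?v + b * ?u"
    by (simp add: algebra_simps)
  moreover have "c * ?u + c * ?v > 0"
    using pos \<open>c > 0\<close> by (simp add: add_pos_pos)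
  ultimately show ?thesis
    unfolding specular_A_def by (simp add: pos_le_divide_eq)
qed

lemma specular_A_minus: "specular_A (- a) (- b) c = - specular_A a b c"
proof -
  have "- a * sqrt (b\<^sup>2 + c\<^sup>2) + - b * sqrt (a\<^sup>2 + c\<^sup>2)
      = - (a * sqrt (b\<^sup>2 + c\<^sup>2) + b * sqrt (a\<^sup>2 + c\<^sup>2))"
    by simp
  then show ?thesis
    unfolding specular_A_def power2_minus by (simp only: minus_divide_left)
qed

lemma has_specular_derivative_minus:
  assumes "has_specular_derivative f L x"
  shows "has_specular_derivative (\<lambda>y. - f y) (- L) x"
proof -
  have "specular_A (- f (x + h) - - f x) (- f x - - f (x - h)) h
      = - specular_A (f (x + h) - f x) (f x - f (x - h)) h" for h
    using specular_A_minus[of "f (x + h) - f x" "f x - f (x - h)" h] by simp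
  then show ?thesis
    using assms unfolding has_specular_derivative_def by (simp add: tendsto_minus)
qed

lemma has_specular_derivative_specular_deriv:
  assumes "specularly_differentiable f x"
  shows "has_specular_derivative f (specular_deriv f x) x"
proof -
  from assms obtain L where L: "has_specular_derivative f L x"
    unfolding specularly_differentiable_def by blast
  moreover have "L' = L" if "has_specular_derivative f L' x" for L'
    using that L unfolding has_specular_derivative_def
    by (intro tendsto_unique) auto
  ultimately show ?thesis
    unfolding specular_deriv_def by (rule theI)
qed

text \<open>The point \<open>c\<close> is where \<open>g\<close> first starts to exceed the level \<open>k\<close>. Taking the infimum of the
  strict superlevel set, and not of \<open>{x. g x = k}\<close>, is what provides points with \<open>g > k\<close>
  arbitrarily close to the right of \<open>c\<close>: after first reaching \<open>k\<close> the function could fall again.\<close>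
lemma continuous_first_crossing:
  fixes g :: "real \<Rightarrow> real"
  assumes "a < b" and cont: "continuous_on {a..b} g" and "g a < k" and "k < g b"
  obtains c where "a < c" and "c < b" and "g c = k"
    and "\<And>x. a \<le> x \<Longrightarrow> x \<le> c \<Longrightarrow> g x \<le> k"
    and "\<And>d. d > 0 \<Longrightarrow> \<exists>x. c < x \<and> x < c + d \<and> k < g x"
proof -
  define S where "S = {x \<in> {a..b}. k < g x}"
  define c where "c = Inf S"
  have "b \<in> S"
    using assms by (auto simp: S_def)
  have bdd: "bdd_below S"
    by (rule bdd_belowI[of _ a]) (auto simp: S_def)
  have below: "c \<le> x" if "x \<in> S" for x
    unfolding c_def using that bdd by (rule cInf_lower)
  have "closed {x \<in> {a..b}. k \<le> g x}"
    by (intro continuous_on_closed_Collect_le cont continuous_intros closed_atLeastAtMost)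
  then have "closure S \<subseteq> {x \<in> {a..b}. k \<le> g x}"
    by (intro closure_minimal) (auto simp: S_def)
  moreover have "c \<in> closure S"
    unfolding c_def using \<open>b \<in> S\<close> bdd by (intro closure_contains_Inf) auto
  ultimately have c: "a \<le> c" "c \<le> b" "k \<le> g c"
    by auto
  have "a < c"
    using c \<open>g a < k\<close> by (cases "a = c") auto
  have "g c \<le> k"
  proof (rule ccontr)
    assume "\<not> g c \<le> k"
    \<comment> \<open>Then an intermediate value strictly above \<open>k\<close> is attained before \<open>c\<close>.\<close>
    moreover have "continuous_on {a..c} g"
      using cont c by (auto intro: continuous_on_subset)
    ultimately obtain x where x: "a \<le> x" "x \<le> c" "g x = (k + g c) / 2"
      using IVT'[of g a "(k + g c) / 2" c] \<open>g a < k\<close> c by auto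
    with \<open>\<not> g c \<le> k\<close> c have "x \<in> S"
      by (auto simp: S_def)
    then have "x = c"
      using below x by force
    then show False
      using x \<open>\<not> g c \<le> k\<close> by simp
  qed
  with c have "g c = k"
    by simp
  then have "c < b"
    using c \<open>k < g b\<close> by (cases "c = b") auto
  have left: "g x \<le> k" if "a \<le> x" "x \<le> c" for x
  proof (rule ccontr)
    assume "\<not> g x \<le> k"
    then have "x \<in> S"
      using that c by (auto simp: S_def)
    then have "x = c"
      using below that by force
    then show False
      using \<open>\<not> g x \<le> k\<close> \<open>g c = k\<close> by simp
  qed
  have right: "\<exists>x. c < x \<and> x < c + d \<and> k < g x" if "d > 0" for d
  proof -
    have "Inf S < c + d"
      using that by (simp add: c_def)
    then obtain x where "x \<in> S" "x < c + d"
      using \<open>b \<in> S\<close> bdd cInf_less_iff[of S "c + d"] by blast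
    moreover have "c < x"
      using below[OF \<open>x \<in> S\<close>] \<open>x \<in> S\<close> \<open>g c = k\<close> by (cases "x = c") (auto simp: S_def)
    ultimately show ?thesis
      by (auto simp: S_def)
  qed
  show ?thesis
    using that \<open>a < c\<close> \<open>c < b\<close> \<open>g c = k\<close> left right by blast
qed

text \<open>The specular derivative is not additive, so one cannot reduce to \<open>m = 0\<close> by subtracting
  \<open>m * x\<close>; the tilted function serves only to find the point at which both slopes of \<open>f\<close> itself
  are compared with \<open>m\<close>.\<close>
lemma specular_mean_value_ge:
  assumes "a < b" and cont: "continuous_on {a..b} f"
    and D: "\<And>x. a < x \<Longrightarrow> x < b \<Longrightarrow> has_specular_derivative f (D x) x"
    and slope: "m * (b - a) < f b - f a"
  shows "\<exists>c. a < c \<and> c < b \<and> m \<le> D c"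
proof -
  define g where "g x = f x - m * x" for x
  have "g a < g b"
    using slope by (simp add: g_def algebra_simps)
  then obtain k where k: "g a < k" "k < g b"
    using dense by blast
  have "continuous_on {a..b} g"
    unfolding g_def by (intro continuous_intros cont)
  then obtain c where c: "a < c" "c < b" "g c = k"
    and left: "\<And>x. a \<le> x \<Longrightarrow> x \<le> c \<Longrightarrow> g x \<le> k"
    and right: "\<And>d. d > 0 \<Longrightarrow> \<exists>x. c < x \<and> x < c + d \<and> k < g x"
    using continuous_first_crossing[of a b g k] \<open>a < b\<close> k by metis
  have "m \<le> D c"
  proof (rule ccontr)
    assume "\<not> m \<le> D c"
    then have "\<forall>\<^sub>F h in at_right 0. specular_A (f (c + h) - f c) (f c - f (c - h)) h < m"
      using D[OF c(1,2)] unfolding has_specular_derivative_def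
      by (intro order_tendstoD(2)) auto
    then obtain d where "d > 0"
      and small: "\<And>h. 0 < h \<Longrightarrow> h < d \<Longrightarrow> specular_A (f (c + h) - f c) (f c - f (c - h)) h < m"
      unfolding eventually_at_right_field by auto
    obtain x where x: "c < x" "x < c + min d (c - a)" "k < g x"
      using right[of "min d (c - a)"] \<open>d > 0\<close> c by auto
    define h where "h = x - c"
    have h: "0 < h" "h < d" "h < c - a"
      using x by (auto simp: h_def)
    have "g (c - h) \<le> k" "k < g (c + h)"
      using left[of "c - h"] h x by (auto simp: h_def)
    then have "m * h \<le> f (c + h) - f c" "m * h \<le> f c - f (c - h)"
      using \<open>g c = k\<close> by (auto simp: g_def algebra_simps)
    then have "m \<le> specular_A (f (c + h) - f c) (f c - f (c - h)) h"
      using h by (intro specular_A_ge) auto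
    with small h show False
      by force
  qed
  with c show ?thesis
    by blast
qed

lemma specular_mean_value_upper:
  assumes "a < b" and "continuous_on {a..b} f"
    and "\<And>x. a < x \<Longrightarrow> x < b \<Longrightarrow> has_specular_derivative f (D x) x"
    and "\<And>x. a < x \<Longrightarrow> x < b \<Longrightarrow> D x < M"
  shows "f b - f a \<le> M * (b - a)"
  using specular_mean_value_ge[of a b f D M] assms by (meson not_le)

lemma specular_mean_value_lower:
  assumes "a < b" and "continuous_on {a..b} f"
    and "\<And>x. a < x \<Longrightarrow> x < b \<Longrightarrow> has_specular_derivative f (D x) x"
    and "\<And>x. a < x \<Longrightarrow> x < b \<Longrightarrow> M < D x"
  shows "M * (b - a) \<le> f b - f a"
proof -
  have "- f b - - f a \<le> - M * (b - a)"
    using assms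
    by (intro specular_mean_value_upper[where D = "\<lambda>x. - D x"] continuous_intros
        has_specular_derivative_minus) auto
  then show ?thesis
    by simp
qed

text \<open>The difference quotient is symmetric in its two arguments, so the mean value inequalities
  apply to points on either side of \<open>x\<close>.\<close>
lemma DERIV_of_continuous_specular_derivative:
  assumes "open I" and "x \<in> I" and cont: "continuous_on I f"
    and D: "\<And>y. y \<in> I \<Longrightarrow> has_specular_derivative f (D y) y"
    and "isCont D x"
  shows "(f has_real_derivative D x) (at x)"
  unfolding has_field_derivative_iff
proof (rule tendstoI)
  fix e :: real
  assume "e > 0"
  obtain r where "r > 0" and r: "ball x r \<subseteq> I"
    using \<open>open I\<close> \<open>x \<in> I\<close> by (auto simp: open_contains_ball)
  have "\<forall>\<^sub>F y in at x. dist (D y) (D x) < e / 2"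
    using \<open>isCont D x\<close> \<open>e > 0\<close> by (intro tendstoD) (auto simp: isCont_def)
  then obtain s where "s > 0" and s: "\<And>y. y \<noteq> x \<Longrightarrow> dist y x < s \<Longrightarrow> dist (D y) (D x) < e / 2"
    unfolding eventually_at by auto
  define d where "d = min r s"
  have "d > 0"
    using \<open>r > 0\<close> \<open>s > 0\<close> by (simp add: d_def)
  have near: "y \<in> I" "D y < D x + e / 2" "D x - e / 2 < D y"
    if "\<bar>y - x\<bar> < d" for y
  proof -
    have "y \<in> ball x r"
      using that by (simp add: d_def dist_real_def abs_minus_commute)
    then show "y \<in> I"
      using r by blast
    have "\<bar>D y - D x\<bar> < e / 2"
      using that s[of y] \<open>e > 0\<close> by (cases "y = x") (auto simp: d_def dist_real_def)
    then show "D y < D x + e / 2" "D x - e / 2 < D y"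
      by linarith+
  qed
  have quotient: "\<bar>(f v - f u) / (v - u) - D x\<bar> < e"
    if "u < v" and uv: "\<And>y. u \<le> y \<Longrightarrow> y \<le> v \<Longrightarrow> \<bar>y - x\<bar> < d" for u v
  proof -
    have sub: "continuous_on {u..v} f"
      using cont near uv by (auto intro: continuous_on_subset)
    have "f v - f u \<le> (D x + e / 2) * (v - u)"
      using \<open>u < v\<close> sub
    proof (rule specular_mean_value_upper)
      fix y assume "u < y" "y < v"
      then show "has_specular_derivative f (D y) y" "D y < D x + e / 2"
        using near[of y] uv[of y] D by simp_all
    qed
    moreover have "(D x - e / 2) * (v - u) \<le> f v - f u"
      using \<open>u < v\<close> sub
    proof (rule specular_mean_value_lower)
      fix y assume "u < y" "y < v"
      then show "has_specular_derivative f (D y) y" "D x - e / 2 < D y"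
        using near[of y] uv[of y] D by simp_all
    qed
    ultimately have "(f v - f u) / (v - u) \<le> D x + e / 2" "D x - e / 2 \<le> (f v - f u) / (v - u)"
      using \<open>u < v\<close> by (simp_all add: pos_divide_le_eq pos_le_divide_eq)
    then show ?thesis
      using \<open>e > 0\<close> by (simp add: abs_less_iff)
  qed
  have "\<bar>(f y - f x) / (y - x) - D x\<bar> < e" if "y \<noteq> x" "\<bar>y - x\<bar> < d" for y
  proof (cases "x < y")
    case True
    then show ?thesis
      using that by (intro quotient) auto
  next
    case False
    then have "\<bar>(f x - f y) / (x - y) - D x\<bar> < e"
      using that by (intro quotient) auto
    moreover have "(f x - f y) / (x - y) = (f y - f x) / (y - x)"
      using minus_divide_divide[of "f y - f x" "y - x"] by simp
    ultimately show ?thesis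
      by simp
  qed
  then show "\<forall>\<^sub>F y in at x. dist ((f y - f x) / (y - x)) (D x) < e"
    using \<open>d > 0\<close> unfolding eventually_at dist_real_def by auto
qed

theorem theorem5p8:
  fixes I :: "real set" and f :: "real \<Rightarrow> real"
  assumes "open I" and "is_interval I"
    and "f \<in> S1 I"
    and "specular_deriv f \<in> C0 I"
  shows "f \<in> C1 I \<and> (\<forall>x\<in>I. deriv f x = specular_deriv f x)"
proof -
  have cont: "continuous_on I f" and cont': "continuous_on I (specular_deriv f)"
    and "\<And>x. x \<in> I \<Longrightarrow> has_specular_derivative f (specular_deriv f x) x"
    using assms(3,4)
    by (auto simp: S1_def S0_def C0_def intro: has_specular_derivative_specular_deriv)
  then have der: "(f has_real_derivative specular_deriv f x) (at x)" if "x \<in> I" for x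
    using that \<open>open I\<close>
    by (intro DERIV_of_continuous_specular_derivative[of I])
      (auto simp: continuous_on_eq_continuous_at)
  then have eq: "deriv f x = specular_deriv f x" if "x \<in> I" for x
    using that by (intro DERIV_imp_deriv)
  then have "continuous_on I (deriv f)"
    using cont' continuous_on_cong by blast
  then show ?thesis
    using der eq by (auto simp: C1_def real_differentiable_def)
qed

end
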